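(* Consider the coupled projected differential inclusion $$\dot x(t)\in \mathcal P^{x(t)}_{\mathcal T_{\mathcal X}(x(t))}\big(-\partial_x' L(x(t),\gamma(t))\big),\qquad \dot\gamma(t)\in \mathcal P^{\gamma(t)}_{\mathcal T_{\mathcal Y}(\gamma(t))}\big(\partial_\gamma'^{+} L(x(t),\gamma(t))\big),\qquad (x(0),\gamma(0))=(x_0,\gamma_0), \tag{P}$$ and the coupled differential inclusion $$\dot x(t)\in -\nabla^2R_x(x(t))^{-1}\big(\partial_xL(x(t),\gamma(t))+\mathcal N_{\mathcal X}(x(t))\big),\qquad \dot\gamma(t)\in \nabla^2R_\gamma(\gamma(t))^{-1}\big(\partial_\gamma^+L(x(t),\gamma(t))-\mathcal N_{\mathcal Y}(\gamma(t))\big),\qquad (x(0),\gamma(0))=(x_0,\gamma_0). \tag{N}$$ For every initial condition $(x_0,\gamma_0)\in\mathcal X\times\mathcal Y$, every viable Caratheodory solution of (P) (if one exists) is a viable Caratheodory solution of (N), and conversely every viable Caratheodory solution of (N) is a viable Caratheodory solution of (P).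
   Context: Setting. $\mathcal X\subseteq\mathbb R^n$, $\mathcal Y\subseteq\mathbb R^m$ are nonempty, convex and compact. $L:\mathbb R^n\times\mathbb R^m\to[-\infty,+\infty]$ is convex in $x\in\mathbb R^n$ and concave in $\gamma\in\mathbb R^m$. For $(x,\gamma)\in\mathcal X\times\mathcal Y$, $\partial_xL(x,\gamma)=\{g\in\mathbb R^n: L(y,\gamma)\ge L(x,\gamma)+\langle g,y-x\rangle\ \forall y\in\mathbb R^n\}$ and $\partial_\gamma^+L(x,\gamma)=\{g\in\mathbb R^m: L(x,\delta)\le L(x,\gamma)+\langle g,\delta-\gamma\rangle\ \forall \delta\in\mathbb R^m\}$. A saddle point is $(x^*,\gamma^* )\in\mathcal X\times\mathcal Y$ with $L(x^*,\gamma)\le L(x^*,\gamma^* )\le L(x,\gamma^* )$ for all $x\in\mathcal X,\gamma\in\mathcal Y$; $\mathcal S$ is the set of saddle points. Standing assumptions. (A1) $\mathcal S$ is nonempty and compact, and for every $(x,\gamma)\in(\mathcal X\times\mathcal Y)\setminus\mathcal S$ there is $(x^*,\gamma^* )\in\mathcal S$ with $L(x^*,\gamma)<L(x^*,\gamma^* )$ or $L(x^*,\gamma^* )<L(x,\gamma^* )$. (A2) For each $x\in\mathcal X$, $L(x,\cdot)$ is upper semicontinuous on $\mathbb R^m$; for each $\gamma\in\mathcal Y$, $L(\cdot,\gamma)$ is lower semicontinuous on $\mathbb R^n$. (A3) For each $(x,\gamma)\in\mathcal X\times\mathcal Y$, $\partial_xL(x,\gamma)\times\partial_\gamma^+L(x,\gamma)$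 is nonempty, and there is $G>0$ such that all elements of $\partial_xL(x,\gamma)$ and $\partial^+_\gamma L(x,\gamma)$, for all $(x,\gamma)\in\mathcal X\times\mathcal Y$, have norm at most $G$. $R_x$ (on $\mathbb R^n$) and $R_\gamma$ (on $\mathbb R^m$) are extended-real-valued functions, twice continuously differentiable on open sets containing $\mathcal X$ and $\mathcal Y$ respectively, and $\sigma_R$-strongly convex ($\sigma_R>0$). Riemannian objects. For $x\in\mathcal X$: $\langle u_1,u_2\rangle_x=u_1^\top\nabla^2R_x(x)u_2$, $\|u\|_x^2=\langle u,u\rangle_x$ on $\mathbb R^n$; for $\gamma\in\mathcal Y$: $\langle v_1,v_2\rangle_\gamma=v_1^\top\nabla^2R_\gamma(\gamma)v_2$, $\|v\|_\gamma^2=\langle v,v\rangle_\gamma$ on $\mathbb R^m$. The Riemannian sub/superdifferentials are $\partial_x'L(x,\gamma)=\nabla^2R_x(x)^{-1}\partial_xL(x,\gamma)$ and $\partial_\gamma'^{+}L(x,\gamma)=\nabla^2R_\gamma(\gamma)^{-1}\partial_\gamma^+L(x,\gamma)$. Tangent and normal cones of a closed convex set $\mathcal C$ at $x\in \mathcal C$: $\mathcal T_{\mathcal C}(x)=\{v: v=\lim_k (x_k-x)/t_k,\ x_k\in\mathcal C,\ t_k\downarrow0\}$ and $\mathcal N_{\mathcal C}(x)=\{\eta:\langle\eta,v\rangle\le0\ \forall v\in\mathcal T_{\mathcal C}(x)\}$. Projections: for a vector $d$, $\mathcal P^x_{\mathcal T_{\mathcal X}(x)}(d)=\operatorname{argmin}_{\nu\in\mathcal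 T_{\mathcal X}(x)}\|\nu-d\|_x^2$ and $\mathcal P^\gamma_{\mathcal T_{\mathcal Y}(\gamma)}(d)=\operatorname{argmin}_{\nu\in\mathcal T_{\mathcal Y}(\gamma)}\|\nu-d\|_\gamma^2$; for a set $D$, the projection of $D$ is the set of projections of its elements, and $-D=\{-d:d\in D\}$. A viable Caratheodory solution of a differential inclusion on $\mathcal X\times\mathcal Y$ is an absolutely continuous map $(x,\gamma):[0,\infty)\to\mathcal X\times\mathcal Y$ satisfying the initial condition and satisfying the inclusion for almost every $t$. *)

theory Defs
  imports "HOL-Analysis.Analysis"
begin

text \<open>Extended-real-valued functions: convexity is convexity of the epigraph, which needs no
  convention for \<open>\<infinity> - \<infinity>\<close>.\<close>

definition ereal_convex :: "('a::real_vector \<Rightarrow> ereal) \<Rightarrow> bool" where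
  "ereal_convex f \<longleftrightarrow> convex {(x, r::real). f x \<le> ereal r}"

definition ereal_concave :: "('a::real_vector \<Rightarrow> ereal) \<Rightarrow> bool" where
  "ereal_concave f \<longleftrightarrow> ereal_convex (\<lambda>x. - f x)"

text \<open>In \<^typ>\<open>ereal\<close> one has \<open>\<infinity> + (-\<infinity>) = \<infinity>\<close>, so the inequality below is vacuous whenever
  one endpoint has value \<open>\<infinity>\<close>.\<close>

definition ereal_strongly_convex :: "real \<Rightarrow> ('a::real_normed_vector \<Rightarrow> ereal) \<Rightarrow> bool" where
  "ereal_strongly_convex \<sigma> f \<longleftrightarrow>
    (\<forall>x y. \<forall>u::real. 0 < u \<and> u < 1 \<longrightarrow>
      f (u *\<^sub>R x + (1 - u) *\<^sub>R y)
        \<le> ereal u * f x + ereal (1 - u) * f y - ereal (\<sigma> / 2 * u * (1 - u) * (norm (x - y))\<^sup>2))"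

definition lower_semicont :: "('a::topological_space \<Rightarrow> ereal) \<Rightarrow> bool" where
  "lower_semicont f \<longleftrightarrow> (\<forall>x. f x \<le> Liminf (at x) f)"

definition upper_semicont :: "('a::topological_space \<Rightarrow> ereal) \<Rightarrow> bool" where
  "upper_semicont f \<longleftrightarrow> (\<forall>x. Limsup (at x) f \<le> f x)"

definition subdiff_x ::
  "('a::real_inner \<Rightarrow> 'b \<Rightarrow> ereal) \<Rightarrow> 'a \<Rightarrow> 'b \<Rightarrow> 'a set" where
  "subdiff_x L x \<gamma> = {g. \<forall>y. L x \<gamma> + ereal (g \<bullet> (y - x)) \<le> L y \<gamma>}"

definition superdiff_\<gamma> ::
  "('a \<Rightarrow> 'b::real_inner \<Rightarrow> ereal) \<Rightarrow> 'a \<Rightarrow> 'b \<Rightarrow> 'b set" where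
  "superdiff_\<gamma> L x \<gamma> = {g. \<forall>\<delta>. L x \<delta> \<le> L x \<gamma> + ereal (g \<bullet> (\<delta> - \<gamma>))}"

definition saddle_points :: "'a set \<Rightarrow> 'b set \<Rightarrow> ('a \<Rightarrow> 'b \<Rightarrow> ereal) \<Rightarrow> ('a \<times> 'b) set" where
  "saddle_points X Y L =
    {(xs, \<gamma>s). xs \<in> X \<and> \<gamma>s \<in> Y \<and> (\<forall>x\<in>X. \<forall>\<gamma>\<in>Y. L xs \<gamma> \<le> L xs \<gamma>s \<and> L xs \<gamma>s \<le> L x \<gamma>s)}"

definition gradient :: "('a::real_inner \<Rightarrow> real) \<Rightarrow> 'a \<Rightarrow> 'a" where
  "gradient f x = (THE D. GDERIV f x :> D)"

definition hessian :: "(real^'n \<Rightarrow> real) \<Rightarrow> real^'n \<Rightarrow> real^'n^'n" where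
  "hessian f x = jacobian (gradient f) (at x)"

definition C2_on :: "(real^'n) set \<Rightarrow> (real^'n \<Rightarrow> real) \<Rightarrow> bool" where
  "C2_on U f \<longleftrightarrow> open U \<and> f differentiable_on U \<and> gradient f differentiable_on U \<and>
    continuous_on U (hessian f)"

text \<open>An extended-real-valued function that is \<open>C\<^sup>2\<close> on \<open>U\<close> is in particular finite there.\<close>

definition ereal_C2_on :: "(real^'n) set \<Rightarrow> (real^'n \<Rightarrow> ereal) \<Rightarrow> bool" where
  "ereal_C2_on U R \<longleftrightarrow> (\<forall>x\<in>U. \<bar>R x\<bar> \<noteq> \<infinity>) \<and> C2_on U (\<lambda>x. real_of_ereal (R x))"

text \<open>The metric tensor at \<open>x\<close>; meaningful where \<open>R\<close> is finite and twice differentiable.\<close>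

definition metric :: "(real^'n \<Rightarrow> ereal) \<Rightarrow> real^'n \<Rightarrow> real^'n^'n" where
  "metric R x = hessian (\<lambda>y. real_of_ereal (R y)) x"

definition riem_inner :: "real^'n^'n \<Rightarrow> real^'n \<Rightarrow> real^'n \<Rightarrow> real" where
  "riem_inner M u v = u \<bullet> (M *v v)"

definition riem_norm_sq :: "real^'n^'n \<Rightarrow> real^'n \<Rightarrow> real" where
  "riem_norm_sq M u = riem_inner M u u"

definition matrix_inv_image :: "real^'n^'n \<Rightarrow> (real^'n) set \<Rightarrow> (real^'n) set" where
  "matrix_inv_image M D = (\<lambda>g. matrix_inv M *v g) ` D"

definition riem_subdiff_x ::
  "(real^'n \<Rightarrow> ereal) \<Rightarrow> (real^'n \<Rightarrow> 'b \<Rightarrow> ereal) \<Rightarrow> real^'n \<Rightarrow> 'b \<Rightarrow> (real^'n) set" where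
  "riem_subdiff_x R L x \<gamma> = matrix_inv_image (metric R x) (subdiff_x L x \<gamma>)"

definition riem_superdiff_\<gamma> ::
  "(real^'m \<Rightarrow> ereal) \<Rightarrow> ('a \<Rightarrow> real^'m \<Rightarrow> ereal) \<Rightarrow> 'a \<Rightarrow> real^'m \<Rightarrow> (real^'m) set" where
  "riem_superdiff_\<gamma> R L x \<gamma> = matrix_inv_image (metric R \<gamma>) (superdiff_\<gamma> L x \<gamma>)"

definition tangent_cone :: "'a::real_normed_vector set \<Rightarrow> 'a \<Rightarrow> 'a set" where
  "tangent_cone C x =
    {v. \<exists>(xs::nat \<Rightarrow> 'a) (t::nat \<Rightarrow> real).
          (\<forall>k. xs k \<in> C) \<and> (\<forall>k. t k > 0) \<and> decseq t \<and> t \<longlonglongrightarrow> 0 \<and>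
          (\<lambda>k. (xs k - x) /\<^sub>R t k) \<longlonglongrightarrow> v}"

definition normal_cone :: "'a::real_inner set \<Rightarrow> 'a \<Rightarrow> 'a set" where
  "normal_cone C x = {\<eta>. \<forall>v\<in>tangent_cone C x. \<eta> \<bullet> v \<le> 0}"

text \<open>The argmin is kept set-valued, so no choice is made if a minimiser does not exist or is not
  unique.\<close>

definition riem_proj :: "real^'n^'n \<Rightarrow> (real^'n) set \<Rightarrow> real^'n \<Rightarrow> (real^'n) set" where
  "riem_proj M T d = {p. is_arg_min (\<lambda>\<nu>. riem_norm_sq M (\<nu> - d)) (\<lambda>\<nu>. \<nu> \<in> T) p}"

definition riem_proj_set :: "real^'n^'n \<Rightarrow> (real^'n) set \<Rightarrow> (real^'n) set \<Rightarrow> (real^'n) set" where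
  "riem_proj_set M T D = (\<Union>d\<in>D. riem_proj M T d)"

definition abs_continuous_on :: "real set \<Rightarrow> (real \<Rightarrow> 'a::real_normed_vector) \<Rightarrow> bool" where
  "abs_continuous_on S f \<longleftrightarrow>
    (\<forall>\<epsilon>>0. \<exists>\<delta>>0. \<forall>D. finite D \<and> (\<forall>(a, b)\<in>D. a < b \<and> {a..b} \<subseteq> S) \<and>
        disjoint_family_on (\<lambda>(a, b). {a<..<b}) D \<and> (\<Sum>(a, b)\<in>D. b - a) < \<delta> \<longrightarrow>
        (\<Sum>(a, b)\<in>D. norm (f b - f a)) < \<epsilon>)"

text \<open>On the unbounded time interval, absolute continuity means absolute continuity on every compact
  subinterval. Only the values \<open>z t\<close> with \<open>t \<ge> 0\<close> matter.\<close>

definition viable_caratheodory_solution ::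
  "'a::real_normed_vector set \<Rightarrow> ('a \<Rightarrow> 'a set) \<Rightarrow> 'a \<Rightarrow> (real \<Rightarrow> 'a) \<Rightarrow> bool" where
  "viable_caratheodory_solution K F z0 z \<longleftrightarrow>
    (\<forall>T>0. abs_continuous_on {0..T} z) \<and> (\<forall>t\<ge>0. z t \<in> K) \<and> z 0 = z0 \<and>
    (AE t in lebesgue. t \<ge> 0 \<longrightarrow>
      (\<exists>v \<in> F (z t). (z has_vector_derivative v) (at t within {0..})))"

definition projected_inclusion ::
  "(real^'n) set \<Rightarrow> (real^'m) set \<Rightarrow> (real^'n \<Rightarrow> real^'m \<Rightarrow> ereal) \<Rightarrow>
   (real^'n \<Rightarrow> ereal) \<Rightarrow> (real^'m \<Rightarrow> ereal) \<Rightarrow>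
   (real^'n) \<times> (real^'m) \<Rightarrow> ((real^'n) \<times> (real^'m)) set" where
  "projected_inclusion X Y L Rx R\<gamma> = (\<lambda>(x, \<gamma>).
     riem_proj_set (metric Rx x) (tangent_cone X x) (uminus ` riem_subdiff_x Rx L x \<gamma>) \<times>
     riem_proj_set (metric R\<gamma> \<gamma>) (tangent_cone Y \<gamma>) (riem_superdiff_\<gamma> R\<gamma> L x \<gamma>))"

definition normal_cone_inclusion ::
  "(real^'n) set \<Rightarrow> (real^'m) set \<Rightarrow> (real^'n \<Rightarrow> real^'m \<Rightarrow> ereal) \<Rightarrow>
   (real^'n \<Rightarrow> ereal) \<Rightarrow> (real^'m \<Rightarrow> ereal) \<Rightarrow>
   (real^'n) \<times> (real^'m) \<Rightarrow> ((real^'n) \<times> (real^'m)) set" where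
  "normal_cone_inclusion X Y L Rx R\<gamma> = (\<lambda>(x, \<gamma>).
     uminus ` matrix_inv_image (metric Rx x)
       {g + \<eta> | g \<eta>. g \<in> subdiff_x L x \<gamma> \<and> \<eta> \<in> normal_cone X x} \<times>
     matrix_inv_image (metric R\<gamma> \<gamma>)
       {g - \<eta> | g \<eta>. g \<in> superdiff_\<gamma> L x \<gamma> \<and> \<eta> \<in> normal_cone Y \<gamma>})"

end

theory Submission
  imports Defs
begin

text \<open>
  The two inclusions are compared velocity by velocity. Fix a time \<open>t > 0\<close> at which the trajectory
  has a derivative, and let \<open>v\<close> be one of its two components. Write \<open>M\<close> for the metric at the current
  point, \<open>T\<close> and \<open>N\<close> for the tangent and normal cones there, and \<open>d = M\<^sup>-\<^sup>1 g\<close> for the Riemannian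
  direction to be projected, where \<open>- g\<close> is a subgradient of \<open>L\<close> for the \<open>x\<close>-component and \<open>g\<close> is a
  supergradient for the \<open>\<gamma>\<close>-component.

  If \<open>v\<close> is a projection of \<open>d\<close> onto \<open>T\<close>, the first-order optimality condition on the convex cone
  \<open>T\<close> says that \<open>\<eta> = M (d - v)\<close> lies in \<open>N\<close>, that is \<open>v = M\<^sup>-\<^sup>1 (g - \<eta>)\<close>
  (\<open>riem_proj_variational\<close>).

  Conversely, \<open>v = M\<^sup>-\<^sup>1 (g - \<eta>)\<close> with \<open>\<eta> \<in> N\<close> satisfies half of the optimality condition; the
  missing parts are \<open>v \<in> T\<close> and \<open>\<eta> \<bullet> v = 0\<close>. Both come from viability: the trajectory stays in the
  constraint set before and after \<open>t\<close>, so the forward and backward difference quotients show that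
  both \<open>v\<close> and \<open>- v\<close> are tangent (\<open>two_sided_velocity_tangent\<close>), and then \<open>\<eta> \<bullet> v \<le> 0\<close> and
  \<open>\<eta> \<bullet> (- v) \<le> 0\<close>. Time \<open>0\<close>, where only the forward quotient exists, is a null set.

  All of this needs \<open>M\<close> to be symmetric and positive definite. Both properties are read off from one
  limit, that of the mixed second difference quotient of the metric potential
  (\<open>second_difference_tendsto\<close>): the quotient is symmetric in its two directions, and
  strong convexity bounds it in opposite directions.
\<close>

section \<open>Tangent cones\<close>

text \<open>If \<open>(x\<^sub>k - x) / t\<^sub>k\<close> tends to \<open>v\<close> and \<open>(y\<^sub>k - x) / s\<^sub>k\<close> tends to \<open>w\<close>, then with the harmonic
  step size \<open>r\<^sub>k = t\<^sub>k s\<^sub>k / (t\<^sub>k + s\<^sub>k)\<close> the point that represents the sum of the two quotients is a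
  convex combination of \<open>x\<^sub>k\<close> and \<open>y\<^sub>k\<close>, hence stays in \<open>C\<close>.\<close>

lemma tangent_cone_add:
  fixes C :: "'a::real_normed_vector set"
  assumes C: "convex C" and v: "v \<in> tangent_cone C x" and w: "w \<in> tangent_cone C x"
  shows "v + w \<in> tangent_cone C x"
proof -
  obtain xs t where xs: "\<And>k::nat. xs k \<in> C" and t: "\<And>k. t k > (0::real)" "decseq t" "t \<longlonglongrightarrow> 0"
    and v: "(\<lambda>k. (xs k - x) /\<^sub>R t k) \<longlonglongrightarrow> v"
    using v unfolding tangent_cone_def by blast
  obtain ys s where ys: "\<And>k::nat. ys k \<in> C" and s: "\<And>k. s k > (0::real)" "decseq s" "s \<longlonglongrightarrow> 0"
    and w: "(\<lambda>k. (ys k - x) /\<^sub>R s k) \<longlonglongrightarrow> w"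
    using w unfolding tangent_cone_def by blast
  define r where "r k = inverse (inverse (t k) + inverse (s k))" for k
  define ps where "ps k = (s k / (t k + s k)) *\<^sub>R xs k + (t k / (t k + s k)) *\<^sub>R ys k" for k
  have pos: "t k + s k > 0" for k using t(1)[of k] s(1)[of k] by linarith
  have r_eq: "r k = t k * s k / (t k + s k)" for k
    unfolding r_def using t(1)[of k] s(1)[of k] by (simp add: field_simps)
  have r_pos: "r k > 0" for k
    unfolding r_eq using t(1)[of k] s(1)[of k] pos[of k] by simp
  have r_dec: "decseq r"
    unfolding decseq_def
  proof (intro allI impI)
    fix m n :: nat assume "m \<le> n"
    then have "t n \<le> t m" "s n \<le> s m" using t(2) s(2) by (auto simp: decseq_def)
    then have "inverse (t m) + inverse (s m) \<le> inverse (t n) + inverse (s n)"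
      using t(1)[of n] s(1)[of n] by (intro add_mono le_imp_inverse_le) auto
    then show "r n \<le> r m"
      unfolding r_def using t(1)[of m] s(1)[of m]
      by (intro le_imp_inverse_le) (auto simp: add_pos_pos)
  qed
  have r_lim: "r \<longlonglongrightarrow> 0"
  proof (rule tendsto_sandwich[OF _ _ tendsto_const t(3)])
    show "\<forall>\<^sub>F k in sequentially. 0 \<le> r k" using r_pos by (simp add: less_imp_le)
    have "r k \<le> t k" for k
      unfolding r_eq using t(1)[of k] s(1)[of k] pos[of k] by (simp add: field_simps)
    then show "\<forall>\<^sub>F k in sequentially. r k \<le> t k" by simp
  qed
  have ps: "ps k \<in> C" for k
    unfolding ps_def using t(1)[of k] s(1)[of k] pos[of k]
    by (intro convexD[OF C xs ys]) (auto simp: add_divide_distrib[symmetric] add.commute)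
  have "(ps k - x) /\<^sub>R r k = (xs k - x) /\<^sub>R t k + (ys k - x) /\<^sub>R s k" for k
  proof -
    have x_eq: "x = (s k / (t k + s k)) *\<^sub>R x + (t k / (t k + s k)) *\<^sub>R x"
      using pos[of k] by (simp add: scaleR_add_left[symmetric] add_divide_distrib[symmetric] add.commute)
    have "ps k - x = ps k - ((s k / (t k + s k)) *\<^sub>R x + (t k / (t k + s k)) *\<^sub>R x)"
      by (rule arg_cong[OF x_eq])
    also have "\<dots> = (s k / (t k + s k)) *\<^sub>R (xs k - x) + (t k / (t k + s k)) *\<^sub>R (ys k - x)"
      by (simp add: ps_def scaleR_diff_right)
    finally have "ps k - x = (s k / (t k + s k)) *\<^sub>R (xs k - x) + (t k / (t k + s k)) *\<^sub>R (ys k - x)" .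
    moreover have "inverse (r k) * (s k / (t k + s k)) = inverse (t k)"
      "inverse (r k) * (t k / (t k + s k)) = inverse (s k)"
      using t(1)[of k] s(1)[of k] less_imp_neq[OF pos[of k]] by (simp_all add: r_eq divide_simps)
    ultimately show ?thesis by (simp add: scaleR_add_right)
  qed
  then have "(\<lambda>k. (ps k - x) /\<^sub>R r k) \<longlonglongrightarrow> v + w"
    using tendsto_add[OF v w] by simp
  then show ?thesis
    unfolding tangent_cone_def using ps r_pos r_dec r_lim by blast
qed

lemma tangent_cone_scale:
  fixes C :: "'a::real_normed_vector set"
  assumes v: "v \<in> tangent_cone C x" and c: "c > 0"
  shows "c *\<^sub>R v \<in> tangent_cone C x"
proof -
  obtain xs t where xs: "\<And>k::nat. xs k \<in> C" and t: "\<And>k. t k > (0::real)" "decseq t" "t \<longlonglongrightarrow> 0"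
    and v: "(\<lambda>k. (xs k - x) /\<^sub>R t k) \<longlonglongrightarrow> v"
    using v unfolding tangent_cone_def by blast
  have "\<And>k. t k / c > 0" using t(1) c by simp
  moreover have "decseq (\<lambda>k. t k / c)"
    using t(2) c by (auto simp: decseq_def divide_right_mono)
  moreover have "(\<lambda>k. t k / c) \<longlonglongrightarrow> 0"
    using tendsto_divide[OF t(3) tendsto_const, of c] c by simp
  moreover have "(\<lambda>k. (xs k - x) /\<^sub>R (t k / c)) \<longlonglongrightarrow> c *\<^sub>R v"
    using tendsto_scaleR[OF tendsto_const v, of c] by (simp add: divide_inverse mult.commute)
  ultimately show ?thesis
    unfolding tangent_cone_def using xs
    by (auto intro!: exI[of _ xs] exI[of _ "\<lambda>k. t k / c"])
qed

text \<open>The sign of \<open>c\<close> selects the side from which \<open>t\<close> is approached. Tangent directions are limits of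
  quotients with positive step sizes, so a backward approach yields \<open>- v\<close>.\<close>

lemma difference_quotient_tangent:
  fixes z :: "real \<Rightarrow> 'a::real_normed_vector"
  assumes z: "(z has_vector_derivative v) (at t)" and c: "c \<noteq> 0"
    and C: "\<And>k::nat. z (t + c / real (Suc k)) \<in> C"
  shows "sgn c *\<^sub>R v \<in> tangent_cone C (z t)"
proof -
  define h where "h k = c / real (Suc k)" for k
  have h_nz: "h k \<noteq> 0" for k using c by (simp add: h_def)
  have h0: "h \<longlonglongrightarrow> 0"
    unfolding h_def by (rule LIMSEQ_Suc[OF lim_const_over_n])
  have "((\<lambda>h. norm (z (t + h) - z t - h *\<^sub>R v) / norm h) \<longlongrightarrow> 0) (at 0)"
    using z by (simp add: has_vector_derivative_def has_derivative_at)
  moreover have "\<forall>\<^sub>F h in at 0. norm (z (t + h) - z t - h *\<^sub>R v) / norm h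
      = norm ((z (t + h) - z t) /\<^sub>R h - v)"
  proof (rule eventually_at_topological[THEN iffD2], intro exI[of _ UNIV] conjI ballI impI)
    fix h :: real assume "h \<noteq> 0"
    then have "(z (t + h) - z t) /\<^sub>R h - v = (z (t + h) - z t - h *\<^sub>R v) /\<^sub>R h"
      by (simp add: scaleR_diff_right)
    then show "norm (z (t + h) - z t - h *\<^sub>R v) / norm h = norm ((z (t + h) - z t) /\<^sub>R h - v)"
      by (simp add: divide_inverse mult.commute)
  qed auto
  ultimately have "((\<lambda>h. norm ((z (t + h) - z t) /\<^sub>R h - v)) \<longlongrightarrow> 0) (at 0)"
    by (rule Lim_transform_eventually)
  then have "((\<lambda>h. (z (t + h) - z t) /\<^sub>R h) \<longlongrightarrow> v) (at 0)"
    by (rule LIM_zero_cancel[OF tendsto_norm_zero_cancel])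
  then have "(\<lambda>k. (z (t + h k) - z t) /\<^sub>R h k) \<longlonglongrightarrow> v"
    by (rule filterlim_compose) (use h0 h_nz in \<open>auto simp: filterlim_at\<close>)
  then have "(\<lambda>k. sgn c *\<^sub>R ((z (t + h k) - z t) /\<^sub>R h k)) \<longlonglongrightarrow> sgn c *\<^sub>R v"
    by (intro tendsto_intros)
  moreover have "sgn c *\<^sub>R ((z (t + h k) - z t) /\<^sub>R h k) = (z (t + h k) - z t) /\<^sub>R \<bar>h k\<bar>" for k
    using c by (cases "c > 0") (auto simp: h_def field_simps)
  ultimately have "(\<lambda>k. (z (t + h k) - z t) /\<^sub>R \<bar>h k\<bar>) \<longlonglongrightarrow> sgn c *\<^sub>R v"
    by (simp only:)
  moreover have "\<bar>h k\<bar> > 0" for k using h_nz by simp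
  moreover have "decseq (\<lambda>k. \<bar>h k\<bar>)"
    unfolding decseq_def h_def by (auto intro!: divide_left_mono)
  moreover have "(\<lambda>k. \<bar>h k\<bar>) \<longlonglongrightarrow> 0"
    using tendsto_rabs_zero[OF h0] .
  ultimately show ?thesis
    unfolding tangent_cone_def using C
    by (auto intro!: exI[of _ "\<lambda>k. z (t + h k)"] exI[of _ "\<lambda>k. \<bar>h k\<bar>"] simp: h_def)
qed

lemma two_sided_velocity_tangent:
  fixes z :: "real \<Rightarrow> 'a::real_normed_vector"
  assumes z: "(z has_vector_derivative v) (at t)" and t: "t > 0"
    and C: "\<And>s. s \<ge> 0 \<Longrightarrow> z s \<in> C"
  shows "v \<in> tangent_cone C (z t)" and "- v \<in> tangent_cone C (z t)"
proof -
  have "sgn t *\<^sub>R v \<in> tangent_cone C (z t)"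
    by (rule difference_quotient_tangent[OF z]) (use t C in auto)
  then show "v \<in> tangent_cone C (z t)" using t by simp
  \<comment> \<open>Backward steps of length at most \<open>t\<close> do not leave the time interval.\<close>
  have "0 \<le> t + - t / real (Suc k)" for k
    using t by (simp add: field_simps)
  then have "z (t + - t / real (Suc k)) \<in> C" for k by (rule C)
  with t have "sgn (- t) *\<^sub>R v \<in> tangent_cone C (z t)"
    by (intro difference_quotient_tangent[OF z]) simp
  then show "- v \<in> tangent_cone C (z t)" using t by (simp add: sgn_minus)
qed

section \<open>Projections in the metric of a positive definite matrix\<close>

definition sym_pos_def :: "real^'n^'n \<Rightarrow> bool" where
  "sym_pos_def M \<longleftrightarrow> (\<forall>u v. u \<bullet> (M *v v) = v \<bullet> (M *v u)) \<and> (\<forall>u. u \<noteq> 0 \<longrightarrow> 0 < u \<bullet> (M *v u))"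

lemma sym_pos_def_inverse:
  fixes M :: "real^'n^'n"
  assumes "sym_pos_def M"
  shows "M *v (matrix_inv M *v u) = u" and "matrix_inv M *v (M *v u) = u"
proof -
  have "\<exists>B. B ** M = mat 1"
    unfolding matrix_left_invertible_ker
    using assms unfolding sym_pos_def_def by (metis inner_zero_right less_irrefl)
  then have "invertible M" by (simp add: invertible_left_inverse)
  then have "M ** matrix_inv M = mat 1 \<and> matrix_inv M ** M = mat 1"
    unfolding invertible_def matrix_inv_def by (rule someI_ex)
  then show "M *v (matrix_inv M *v u) = u" "matrix_inv M *v (M *v u) = u"
    by (simp_all add: matrix_vector_mul_assoc)
qed

lemma riem_norm_sq_add:
  assumes "sym_pos_def M"
  shows "riem_norm_sq M (a + b) = riem_norm_sq M a + 2 * ((M *v a) \<bullet> b) + riem_norm_sq M b"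
proof -
  have "a \<bullet> (M *v b) = (M *v a) \<bullet> b" "b \<bullet> (M *v a) = (M *v a) \<bullet> b"
    using assms by (auto simp: sym_pos_def_def inner_commute)
  then show ?thesis
    by (simp add: riem_norm_sq_def riem_inner_def matrix_vector_right_distrib inner_add_left
        inner_add_right)
qed

text \<open>First-order optimality: moving from the minimiser \<open>p\<close> to \<open>p + s w\<close> does not decrease the
  squared distance, and its change is \<open>2 s \<langle>p - d, w\<rangle>\<^sub>M + s\<^sup>2 \<parallel>w\<parallel>\<^sub>M\<^sup>2\<close>; let \<open>s\<close> tend to \<open>0\<close>.\<close>

lemma riem_proj_variational:
  fixes M :: "real^'n^'n"
  assumes M: "sym_pos_def M"
    and T: "\<And>v s. s > 0 \<Longrightarrow> v \<in> T \<Longrightarrow> p + s *\<^sub>R v \<in> T"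
    and p: "p \<in> riem_proj M T d" and w: "w \<in> T"
  shows "(M *v (d - p)) \<bullet> w \<le> 0"
proof -
  have min: "riem_norm_sq M (p - d) \<le> riem_norm_sq M (q - d)" if "q \<in> T" for q
    using p that unfolding riem_proj_def is_arg_min_def by (auto simp: not_less)
  define a where "a = (M *v (p - d)) \<bullet> w"
  define b where "b = riem_norm_sq M w"
  have bound: "0 \<le> 2 * a + s * b" if s: "s > 0" for s
  proof -
    have "riem_norm_sq M (p - d) \<le> riem_norm_sq M ((p - d) + s *\<^sub>R w)"
      using min[OF T[OF s w]] by (simp add: algebra_simps)
    also have "\<dots> = riem_norm_sq M (p - d) + s * (2 * a + s * b)"
      unfolding riem_norm_sq_add[OF M]
      by (simp add: a_def b_def riem_norm_sq_def riem_inner_def matrix_vector_mult_scaleR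
          algebra_simps)
    finally have "0 \<le> s * (2 * a + s * b)" by simp
    then show ?thesis using s by (simp add: zero_le_mult_iff)
  qed
  have "((\<lambda>s. 2 * a + s * b) \<longlongrightarrow> 2 * a + 0 * b) (at_right 0)"
    by (intro tendsto_intros)
  then have "0 \<le> 2 * a + 0 * b"
    by (rule tendsto_lowerbound)
      (auto simp: bound intro: eventually_mono[OF eventually_at_right_less])
  moreover have "(M *v (d - p)) \<bullet> w = - a"
    by (simp add: a_def matrix_vector_mult_diff_distrib inner_diff_left)
  ultimately show ?thesis by simp
qed

text \<open>Pythagoras: \<open>\<parallel>w - d\<parallel>\<^sub>M\<^sup>2 \<ge> \<parallel>w - p\<parallel>\<^sub>M\<^sup>2 + \<parallel>p - d\<parallel>\<^sub>M\<^sup>2\<close> when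
  \<open>\<langle>d - p, w - p\<rangle>\<^sub>M \<le> 0\<close>, and orthogonality reduces this angle condition to \<open>\<langle>d - p, w\<rangle>\<^sub>M \<le> 0\<close>.\<close>

lemma riem_proj_if_orthogonal:
  fixes M :: "real^'n^'n"
  assumes M: "sym_pos_def M" and p: "p \<in> T"
    and orth: "(M *v (d - p)) \<bullet> p = 0" and polar: "\<And>w. w \<in> T \<Longrightarrow> (M *v (d - p)) \<bullet> w \<le> 0"
  shows "p \<in> riem_proj M T d"
proof -
  have "riem_norm_sq M (p - d) \<le> riem_norm_sq M (w - d)" if w: "w \<in> T" for w
  proof -
    have "riem_norm_sq M (w - d) = riem_norm_sq M ((p - d) + (w - p))" by simp
    also have "\<dots> = riem_norm_sq M (p - d) - 2 * ((M *v (d - p)) \<bullet> (w - p)) + riem_norm_sq M (w - p)"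
      unfolding riem_norm_sq_add[OF M]
      by (simp add: matrix_vector_mult_diff_distrib inner_diff_left inner_diff_right)
    also have "(M *v (d - p)) \<bullet> (w - p) = (M *v (d - p)) \<bullet> w"
      using orth by (simp add: inner_diff_right)
    finally have *: "riem_norm_sq M (w - d)
        = riem_norm_sq M (p - d) - 2 * ((M *v (d - p)) \<bullet> w) + riem_norm_sq M (w - p)" .
    have "0 \<le> riem_norm_sq M (w - p)"
      using M unfolding sym_pos_def_def riem_norm_sq_def riem_inner_def
      by (cases "w - p = 0") (auto simp: less_imp_le)
    with * polar[OF w] show ?thesis by linarith
  qed
  then show ?thesis
    using p unfolding riem_proj_def is_arg_min_def by (auto simp: not_less)
qed

text \<open>For a velocity that is tangent in both directions every normal vector is orthogonal to it, which
  supplies the complementarity condition that a general element of \<open>M\<^sup>-\<^sup>1 (g - N)\<close> lacks.\<close>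

lemma projected_velocity_iff:
  fixes M :: "real^'n^'n"
  assumes M: "sym_pos_def M" and C: "convex C"
    and v: "v \<in> tangent_cone C x" "- v \<in> tangent_cone C x"
  shows "v \<in> riem_proj_set M (tangent_cone C x) (matrix_inv_image M D) \<longleftrightarrow>
    v \<in> matrix_inv_image M {g - \<eta> | g \<eta>. g \<in> D \<and> \<eta> \<in> normal_cone C x}"
    (is "?proj \<longleftrightarrow> ?norm")
proof
  assume ?proj
  then obtain g where g: "g \<in> D" and p: "v \<in> riem_proj M (tangent_cone C x) (matrix_inv M *v g)"
    by (auto simp: riem_proj_set_def matrix_inv_image_def)
  define \<eta> where "\<eta> = M *v (matrix_inv M *v g - v)"
  have "\<eta> \<in> normal_cone C x"
    unfolding normal_cone_def \<eta>_def
    using riem_proj_variational[OF M _ p] tangent_cone_add[OF C v(1) tangent_cone_scale] by auto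
  moreover have "v = matrix_inv M *v (g - \<eta>)"
    by (simp add: \<eta>_def matrix_vector_mult_diff_distrib sym_pos_def_inverse[OF M])
  ultimately show ?norm
    using g by (auto simp: matrix_inv_image_def)
next
  assume ?norm
  then obtain g \<eta> where g: "g \<in> D" and \<eta>: "\<eta> \<in> normal_cone C x"
    and v_eq: "v = matrix_inv M *v (g - \<eta>)"
    by (auto simp: matrix_inv_image_def)
  have \<eta>_eq: "M *v (matrix_inv M *v g - v) = \<eta>"
    by (simp add: v_eq matrix_vector_mult_diff_distrib sym_pos_def_inverse[OF M])
  have polar: "\<eta> \<bullet> w \<le> 0" if "w \<in> tangent_cone C x" for w
    using \<eta> that by (auto simp: normal_cone_def)
  have "\<eta> \<bullet> v = 0"
    using polar[OF v(1)] polar[OF v(2)] by simp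
  then have "v \<in> riem_proj M (tangent_cone C x) (matrix_inv M *v g)"
    by (intro riem_proj_if_orthogonal[OF M v(1)]) (simp_all add: \<eta>_eq polar)
  then show ?proj
    using g by (auto simp: riem_proj_set_def matrix_inv_image_def)
qed

section \<open>The Hessian of a strongly convex function\<close>

lemma GDERIV_gradient:
  fixes f :: "'a::euclidean_space \<Rightarrow> real"
  assumes "f differentiable at x"
  shows "GDERIV f x :> gradient f x"
proof -
  obtain f' where f': "(f has_derivative f') (at x)"
    using assms by (auto simp: differentiable_def)
  define D where "D = (\<Sum>b\<in>Basis. f' b *\<^sub>R b)"
  have lin: "linear f'" using f' by (rule has_derivative_linear)
  have "f' h = h \<bullet> D" for h
  proof -
    have "f' h = f' (\<Sum>b\<in>Basis. (h \<bullet> b) *\<^sub>R b)" by (simp add: euclidean_representation)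
    also have "\<dots> = (\<Sum>b\<in>Basis. (h \<bullet> b) * f' b)"
      by (simp add: linear_sum[OF lin] linear_scale[OF lin])
    finally show ?thesis by (simp add: D_def inner_sum_right mult.commute)
  qed
  then have "f' = (\<lambda>h. h \<bullet> D)" by (rule ext)
  then have D: "GDERIV f x :> D"
    using f' by (simp add: gderiv_def)
  have "E = D" if "GDERIV f x :> E" for E
  proof -
    have "(\<lambda>h. h \<bullet> E) = (\<lambda>h. h \<bullet> D)"
      using that D unfolding gderiv_def by (rule has_derivative_unique)
    then show ?thesis by (metis vector_eq_ldot)
  qed
  with D show ?thesis
    unfolding gradient_def by (rule theI)
qed

text \<open>Apply the mean value theorem to \<open>s \<mapsto> f (x + s a + t b) - f (x + s a)\<close> on \<open>[0, t]\<close>. Its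
  derivative \<open>a \<bullet> (G (x + s a + t b) - G (x + s a))\<close> equals \<open>t (a \<bullet> H b)\<close> up to \<open>o(t)\<close> by
  differentiability of the gradient \<open>G\<close> at the single point \<open>x\<close>, uniformly for \<open>0 < s < t\<close>.\<close>

lemma second_difference_tendsto:
  fixes f :: "'a::real_inner \<Rightarrow> real" and G :: "'a \<Rightarrow> 'a"
  assumes U: "open U" "x \<in> U"
    and f: "\<And>y. y \<in> U \<Longrightarrow> GDERIV f y :> G y"
    and G: "(G has_derivative H) (at x)"
  shows "((\<lambda>t. (f (x + t *\<^sub>R a + t *\<^sub>R b) - f (x + t *\<^sub>R a) - f (x + t *\<^sub>R b) + f x) / t\<^sup>2)
    \<longlongrightarrow> a \<bullet> H b) (at_right 0)"
proof (rule tendstoI)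
  fix e :: real assume e: "e > 0"
  define K where "K = norm a + norm b + 1"
  have K: "K > 0" "norm a \<le> K" "norm a + norm b < K" by (auto simp: K_def add_nonneg_pos)
  \<comment> \<open>The final error is at most \<open>2 e' K\<^sup>2\<close>, so this choice leaves room for a strict bound.\<close>
  define e' where "e' = e / (4 * K\<^sup>2)"
  have e': "e' > 0" using e K by (simp add: e'_def)
  have linH: "linear H" using G by (rule has_derivative_linear)
  obtain d1 where d1: "d1 > 0"
    and rem: "\<And>y. norm (y - x) < d1 \<Longrightarrow> norm (G y - G x - H (y - x)) \<le> e' * norm (y - x)"
    using G e' unfolding has_derivative_at_alt by blast
  obtain d2 where d2: "d2 > 0" and ball: "ball x d2 \<subseteq> U"
    using U by (auto simp: open_contains_ball)
  define d where "d = min d1 d2 / K"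
  have d: "d > 0" using d1 d2 K by (simp add: d_def)
  have "dist ((f (x + t *\<^sub>R a + t *\<^sub>R b) - f (x + t *\<^sub>R a) - f (x + t *\<^sub>R b) + f x) / t\<^sup>2) (a \<bullet> H b) < e"
    if t: "0 < t" "t < d" for t
  proof -
    have tK: "t * K < min d1 d2" using t K by (simp add: d_def field_simps)
    have small: "norm (s *\<^sub>R a + c *\<^sub>R b) \<le> t * K" if "0 \<le> s" "s \<le> t" "0 \<le> c" "c \<le> t" for s c
    proof -
      have "norm (s *\<^sub>R a + c *\<^sub>R b) \<le> s * norm a + c * norm b"
        using that norm_triangle_ineq[of "s *\<^sub>R a" "c *\<^sub>R b"] by simp
      also have "\<dots> \<le> t * norm a + t * norm b"
        using that by (intro add_mono mult_right_mono) auto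
      also have "\<dots> = t * (norm a + norm b)"
        by (simp add: algebra_simps)
      also have "\<dots> \<le> t * K"
        using t K by (intro mult_left_mono) auto
      finally show ?thesis .
    qed
    have mem: "x + s *\<^sub>R a + c *\<^sub>R b \<in> U" if "0 \<le> s" "s \<le> t" "0 \<le> c" "c \<le> t" for s c
    proof -
      have "dist x (x + s *\<^sub>R a + c *\<^sub>R b) = norm (s *\<^sub>R a + c *\<^sub>R b)"
        by (metis add.assoc add_diff_cancel_left' dist_commute dist_norm)
      then have "x + s *\<^sub>R a + c *\<^sub>R b \<in> ball x d2"
        using small[OF that] tK by simp
      then show ?thesis using ball by blast
    qed
    define r where "r y = G (x + y) - G x - H y" for y
    have r: "norm (r (s *\<^sub>R a + c *\<^sub>R b)) \<le> e' * (t * K)" if "0 \<le> s" "s \<le> t" "0 \<le> c" "c \<le> t" for s c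
    proof -
      have "norm (r (s *\<^sub>R a + c *\<^sub>R b)) \<le> e' * norm (s *\<^sub>R a + c *\<^sub>R b)"
        using rem[of "x + (s *\<^sub>R a + c *\<^sub>R b)"] small[OF that] tK by (simp add: r_def)
      also have "\<dots> \<le> e' * (t * K)"
        using small[OF that] e' by simp
      finally show ?thesis .
    qed
    define h where "h s = f (x + s *\<^sub>R a + t *\<^sub>R b) - f (x + s *\<^sub>R a)" for s
    have line: "((\<lambda>s. f (x + s *\<^sub>R a + c *\<^sub>R b)) has_real_derivative a \<bullet> G (x + s *\<^sub>R a + c *\<^sub>R b)) (at s)"
      if "0 \<le> s" "s \<le> t" "0 \<le> c" "c \<le> t" for s c
    proof -
      have g: "(f has_derivative (\<lambda>k. k \<bullet> G (x + s *\<^sub>R a + c *\<^sub>R b))) (at (x + s *\<^sub>R a + c *\<^sub>R b))"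
        using f[OF mem[OF that]] by (simp add: gderiv_def)
      have "((\<lambda>s. x + s *\<^sub>R a + c *\<^sub>R b) has_derivative (\<lambda>k. k *\<^sub>R a)) (at s)"
        by (auto intro!: derivative_eq_intros)
      from has_derivative_compose[OF this g] show ?thesis
        by (simp add: has_field_derivative_def mult_commute_abs)
    qed
    have dh: "(h has_real_derivative a \<bullet> (G (x + s *\<^sub>R a + t *\<^sub>R b) - G (x + s *\<^sub>R a))) (at s)"
      if "0 \<le> s" "s \<le> t" for s
      unfolding h_def using DERIV_diff[OF line[OF that, of t] line[OF that, of 0]] t
      by (simp add: inner_diff_right)
    obtain \<xi> where \<xi>: "0 < \<xi>" "\<xi> < t"
      and mvt: "h t - h 0 = t * (a \<bullet> (G (x + \<xi> *\<^sub>R a + t *\<^sub>R b) - G (x + \<xi> *\<^sub>R a)))"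
      using MVT2[OF t(1) dh] by auto
    have eq: "G (x + \<xi> *\<^sub>R a + t *\<^sub>R b) - G (x + \<xi> *\<^sub>R a)
        = t *\<^sub>R H b + (r (\<xi> *\<^sub>R a + t *\<^sub>R b) - r (\<xi> *\<^sub>R a + 0 *\<^sub>R b))"
      by (simp add: r_def linear_add[OF linH] linear_scale[OF linH] add.assoc)
    have "h t - h 0 - t\<^sup>2 * (a \<bullet> H b) = t * (a \<bullet> (r (\<xi> *\<^sub>R a + t *\<^sub>R b) - r (\<xi> *\<^sub>R a + 0 *\<^sub>R b)))"
      unfolding mvt eq by (simp add: inner_add_right power2_eq_square algebra_simps)
    moreover have "\<bar>a \<bullet> (r (\<xi> *\<^sub>R a + t *\<^sub>R b) - r (\<xi> *\<^sub>R a + 0 *\<^sub>R b))\<bar> \<le> K * (2 * (e' * (t * K)))"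
    proof (rule order_trans[OF Cauchy_Schwarz_ineq2], rule mult_mono)
      show "norm (r (\<xi> *\<^sub>R a + t *\<^sub>R b) - r (\<xi> *\<^sub>R a + 0 *\<^sub>R b)) \<le> 2 * (e' * (t * K))"
        using norm_triangle_ineq4[of "r (\<xi> *\<^sub>R a + t *\<^sub>R b)" "r (\<xi> *\<^sub>R a + 0 *\<^sub>R b)"]
          r[of \<xi> t] r[of \<xi> 0] \<xi> t by linarith
    qed (use K in auto)
    ultimately have "\<bar>h t - h 0 - t\<^sup>2 * (a \<bullet> H b)\<bar> \<le> t * (K * (2 * (e' * (t * K))))"
      using t by (simp add: abs_mult)
    also have "\<dots> = t\<^sup>2 * (e / 2)"
      using K by (simp add: e'_def power2_eq_square field_simps)
    finally have "\<bar>h t - h 0 - t\<^sup>2 * (a \<bullet> H b)\<bar> / t\<^sup>2 \<le> e / 2"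
      using t by (simp add: field_simps)
    moreover have "\<bar>h t - h 0 - t\<^sup>2 * (a \<bullet> H b)\<bar> / t\<^sup>2 = \<bar>(h t - h 0) / t\<^sup>2 - a \<bullet> H b\<bar>"
    proof -
      have "(h t - h 0) / t\<^sup>2 - a \<bullet> H b = (h t - h 0 - t\<^sup>2 * (a \<bullet> H b)) / t\<^sup>2"
        using t by (simp add: diff_divide_distrib)
      then show ?thesis by simp
    qed
    ultimately have close: "\<bar>(h t - h 0) / t\<^sup>2 - a \<bullet> H b\<bar> \<le> e / 2"
      by (simp only:)
    have "h t - h 0 = f (x + t *\<^sub>R a + t *\<^sub>R b) - f (x + t *\<^sub>R a) - f (x + t *\<^sub>R b) + f x"
      by (simp add: h_def)
    then show ?thesis using close e by (simp add: dist_real_def)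
  qed
  then show "\<forall>\<^sub>F t in at_right 0.
      dist ((f (x + t *\<^sub>R a + t *\<^sub>R b) - f (x + t *\<^sub>R a) - f (x + t *\<^sub>R b) + f x) / t\<^sup>2) (a \<bullet> H b) < e"
    using d unfolding eventually_at_right_field by blast
qed

text \<open>Symmetry: the second difference quotient does not change when the two directions are swapped.
  Positivity: along \<open>u\<close> and \<open>- u\<close> it becomes \<open>(2 f x - f (x + t u) - f (x - t u)) / t\<^sup>2\<close>, which strong
  convexity at the midpoint \<open>x\<close> bounds above by \<open>- \<sigma> \<parallel>u\<parallel>\<^sup>2\<close>.\<close>

lemma sym_pos_def_metric:
  fixes R :: "real^'n \<Rightarrow> ereal"
  assumes C2: "ereal_C2_on U R" and x: "x \<in> U"
    and strong: "ereal_strongly_convex \<sigma> R" and \<sigma>: "\<sigma> > 0"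
  shows "sym_pos_def (metric R x)"
proof -
  define f where "f y = real_of_ereal (R y)" for y
  have fin: "R y = ereal (f y)" if "y \<in> U" for y
    using C2 that by (auto simp: ereal_C2_on_def f_def ereal_real')
  have U: "open U" and df: "f differentiable_on U" and dg: "gradient f differentiable_on U"
    using C2 unfolding f_def ereal_C2_on_def C2_on_def by blast+
  have grad: "GDERIV f y :> gradient f y" if "y \<in> U" for y
    using df U that by (intro GDERIV_gradient) (simp add: differentiable_on_eq_differentiable_at)
  have M: "metric R x = jacobian (gradient f) (at x)"
    unfolding metric_def hessian_def by (simp only: f_def[abs_def])
  have hess: "(gradient f has_derivative (\<lambda>h. metric R x *v h)) (at x)"
    using dg U x unfolding M jacobian_works[symmetric]
    by (simp add: differentiable_on_eq_differentiable_at)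
  have lim: "((\<lambda>t. (f (x + t *\<^sub>R a + t *\<^sub>R b) - f (x + t *\<^sub>R a) - f (x + t *\<^sub>R b) + f x) / t\<^sup>2)
      \<longlongrightarrow> a \<bullet> (metric R x *v b)) (at_right 0)" for a b
    by (rule second_difference_tendsto[OF U x grad hess])
  have sym: "u \<bullet> (metric R x *v v) = v \<bullet> (metric R x *v u)" for u v
  proof -
    have "((\<lambda>t. (f (x + t *\<^sub>R u + t *\<^sub>R v) - f (x + t *\<^sub>R u) - f (x + t *\<^sub>R v) + f x) / t\<^sup>2)
        \<longlongrightarrow> v \<bullet> (metric R x *v u)) (at_right 0)"
      using lim[of v u] by (simp add: algebra_simps)
    then show ?thesis
      by (intro tendsto_unique[OF _ lim[of u v]]) simp_all
  qed
  have "\<sigma> * (norm u)\<^sup>2 \<le> u \<bullet> (metric R x *v u)" for u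
  proof -
    define q where "q t = (f (x + t *\<^sub>R u + t *\<^sub>R (- u)) - f (x + t *\<^sub>R u) - f (x + t *\<^sub>R (- u)) + f x) / t\<^sup>2" for t
    have near: "\<forall>\<^sub>F t in at_right 0. x + t *\<^sub>R w \<in> U" for w
    proof -
      have "((\<lambda>t. x + t *\<^sub>R w) \<longlongrightarrow> x + 0 *\<^sub>R w) (at_right 0)"
        by (intro tendsto_intros)
      then show ?thesis using U x by (intro topological_tendstoD) auto
    qed
    have "\<forall>\<^sub>F t in at_right 0. q t \<le> - (\<sigma> * (norm u)\<^sup>2)"
      using near[of u] near[of "- u"] eventually_at_right_less[of 0]
    proof eventually_elim
      case (elim t)
      let ?y = "x + t *\<^sub>R u" and ?z = "x + t *\<^sub>R (- u)"
      have mid: "(1/2) *\<^sub>R ?y + (1 - 1/2) *\<^sub>R ?z = x"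
        by (simp add: vec_eq_iff field_simps)
      have len: "norm (?y - ?z) = 2 * t * norm u"
      proof -
        have "?y - ?z = (2 * t) *\<^sub>R u" by (simp add: scaleR_2 flip: scaleR_scaleR)
        then show ?thesis using elim by simp
      qed
      have "R ((1/2) *\<^sub>R ?y + (1 - 1/2) *\<^sub>R ?z)
          \<le> ereal (1/2) * R ?y + ereal (1 - 1/2) * R ?z
            - ereal (\<sigma> / 2 * (1/2) * (1 - 1/2) * (norm (?y - ?z))\<^sup>2)"
        by (rule strong[unfolded ereal_strongly_convex_def, rule_format]) simp
      then have "f x \<le> f ?y / 2 + f ?z / 2 - \<sigma> / 8 * (2 * t * norm u)\<^sup>2"
        unfolding mid len fin[OF x] fin[OF elim(1)] fin[OF elim(2)] by simp
      then have "2 * f x - f ?y - f ?z \<le> - (\<sigma> * (norm u)\<^sup>2) * t\<^sup>2"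
        by (simp add: power_mult_distrib algebra_simps)
      then show ?case
        using elim by (simp add: q_def field_simps)
    qed
    with lim[of u "- u", folded q_def] have "u \<bullet> (metric R x *v (- u)) \<le> - (\<sigma> * (norm u)\<^sup>2)"
      by (rule tendsto_upperbound) (rule trivial_limit_at_right_real)
    then show ?thesis by (simp add: linear_neg[OF matrix_vector_mul_linear])
  qed
  moreover have "0 < \<sigma> * (norm u)\<^sup>2" if "u \<noteq> 0" for u :: "real^'n"
    using \<sigma> that by simp
  ultimately show ?thesis
    unfolding sym_pos_def_def using sym by (meson less_le_trans)
qed

section \<open>Equivalence of the two inclusions\<close>

text \<open>Turns the \<open>x\<close>-component of both inclusions, which carries a minus sign, into the form of the
  \<open>\<gamma>\<close>-component.\<close>

lemma matrix_inv_image_uminus: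
  fixes M :: "real^'n^'n"
  shows "uminus ` matrix_inv_image M D = matrix_inv_image M (uminus ` D)"
  by (simp add: matrix_inv_image_def image_image linear_neg[OF matrix_vector_mul_linear])

theorem lemma1:
  fixes X :: "(real^'n) set" and Y :: "(real^'m) set"
    and L :: "real^'n \<Rightarrow> real^'m \<Rightarrow> ereal"
    and Rx :: "real^'n \<Rightarrow> ereal" and R\<gamma> :: "real^'m \<Rightarrow> ereal"
    and \<sigma> :: real and x0 :: "real^'n" and \<gamma>0 :: "real^'m"
    and z :: "real \<Rightarrow> (real^'n) \<times> (real^'m)"
  assumes X: "X \<noteq> {}" "convex X" "compact X"
    and Y: "Y \<noteq> {}" "convex Y" "compact Y"
    and L_convex: "\<And>\<gamma>. ereal_convex (\<lambda>x. L x \<gamma>)"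
    and L_concave: "\<And>x. ereal_concave (L x)"
    and A1_saddle: "saddle_points X Y L \<noteq> {}" "compact (saddle_points X Y L)"
    and A1_strict: "\<And>x \<gamma>. (x, \<gamma>) \<in> (X \<times> Y) - saddle_points X Y L \<Longrightarrow>
        \<exists>(xs, \<gamma>s) \<in> saddle_points X Y L. L xs \<gamma> < L xs \<gamma>s \<or> L xs \<gamma>s < L x \<gamma>s"
    and A2_usc: "\<And>x. x \<in> X \<Longrightarrow> upper_semicont (L x)"
    and A2_lsc: "\<And>\<gamma>. \<gamma> \<in> Y \<Longrightarrow> lower_semicont (\<lambda>x. L x \<gamma>)"
    and A3_nonempty: "\<And>x \<gamma>. x \<in> X \<Longrightarrow> \<gamma> \<in> Y \<Longrightarrow> subdiff_x L x \<gamma> \<times> superdiff_\<gamma> L x \<gamma> \<noteq> {}"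
    and A3_bounded: "\<exists>G>0. \<forall>x\<in>X. \<forall>\<gamma>\<in>Y.
        (\<forall>g\<in>subdiff_x L x \<gamma>. norm g \<le> G) \<and> (\<forall>g\<in>superdiff_\<gamma> L x \<gamma>. norm g \<le> G)"
    and Rx_C2: "\<exists>U. open U \<and> X \<subseteq> U \<and> ereal_C2_on U Rx"
    and R\<gamma>_C2: "\<exists>V. open V \<and> Y \<subseteq> V \<and> ereal_C2_on V R\<gamma>"
    and \<sigma>: "\<sigma> > 0"
    and Rx_strong: "ereal_strongly_convex \<sigma> Rx"
    and R\<gamma>_strong: "ereal_strongly_convex \<sigma> R\<gamma>"
    and init: "(x0, \<gamma>0) \<in> X \<times> Y"
  shows "viable_caratheodory_solution (X \<times> Y) (projected_inclusion X Y L Rx R\<gamma>) (x0, \<gamma>0) z \<longleftrightarrow>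
         viable_caratheodory_solution (X \<times> Y) (normal_cone_inclusion X Y L Rx R\<gamma>) (x0, \<gamma>0) z"
proof -
  obtain U V where U: "X \<subseteq> U" "ereal_C2_on U Rx" and V: "Y \<subseteq> V" "ereal_C2_on V R\<gamma>"
    using Rx_C2 R\<gamma>_C2 by blast
  have Mx: "sym_pos_def (metric Rx x)" if "x \<in> X" for x
    using sym_pos_def_metric[OF U(2) _ Rx_strong \<sigma>] U(1) that by blast
  have M\<gamma>: "sym_pos_def (metric R\<gamma> \<gamma>)" if "\<gamma> \<in> Y" for \<gamma>
    using sym_pos_def_metric[OF V(2) _ R\<gamma>_strong \<sigma>] V(1) that by blast
  let ?P = "projected_inclusion X Y L Rx R\<gamma>" and ?N = "normal_cone_inclusion X Y L Rx R\<gamma>"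
  have velocity: "v \<in> ?P (z t) \<longleftrightarrow> v \<in> ?N (z t)"
    if z: "\<And>s. s \<ge> 0 \<Longrightarrow> z s \<in> X \<times> Y" and t: "t > 0"
      and v: "(z has_vector_derivative v) (at t within {0..})" for v t
  proof -
    have "at t within {0..} = at t"
      using t by (intro at_within_interior) simp
    then have v: "(z has_vector_derivative v) (at t)" using v by simp
    obtain x \<gamma> where xg: "z t = (x, \<gamma>)" by fastforce
    obtain p q where pq: "v = (p, q)" by fastforce
    have x: "x \<in> X" and \<gamma>: "\<gamma> \<in> Y" using z[of t] t xg by auto
    have "((\<lambda>s. fst (z s)) has_vector_derivative p) (at t)"
      using bounded_linear.has_vector_derivative[OF bounded_linear_fst v] pq by simp
    from two_sided_velocity_tangent[OF this t, of X] z
    have p: "p \<in> tangent_cone X x" "- p \<in> tangent_cone X x"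
      by (auto simp: xg mem_Times_iff)
    have "((\<lambda>s. snd (z s)) has_vector_derivative q) (at t)"
      using bounded_linear.has_vector_derivative[OF bounded_linear_snd v] pq by simp
    from two_sided_velocity_tangent[OF this t, of Y] z
    have q: "q \<in> tangent_cone Y \<gamma>" "- q \<in> tangent_cone Y \<gamma>"
      by (auto simp: xg mem_Times_iff)
    have neg: "uminus ` {g + \<eta> | g \<eta>. g \<in> subdiff_x L x \<gamma> \<and> \<eta> \<in> normal_cone X x}
        = {g - \<eta> | g \<eta>. g \<in> uminus ` subdiff_x L x \<gamma> \<and> \<eta> \<in> normal_cone X x}"
      by (force simp: image_iff)
    show ?thesis
      unfolding xg pq projected_inclusion_def normal_cone_inclusion_def
        riem_subdiff_x_def riem_superdiff_\<gamma>_def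
      by (simp add: matrix_inv_image_uminus neg projected_velocity_iff[OF Mx[OF x] X(2) p]
          projected_velocity_iff[OF M\<gamma>[OF \<gamma>] Y(2) q])
  qed
  \<comment> \<open>At time \<open>0\<close> there is no backward quotient, so this instant is discarded.\<close>
  have ae: "AE t in lebesgue. t \<noteq> (0::real)"
    by (rule AE_I'[of "{0}"]) (auto simp: null_sets_def)
  have "(AE t in lebesgue. t \<ge> 0 \<longrightarrow>
        (\<exists>v \<in> ?P (z t). (z has_vector_derivative v) (at t within {0..}))) \<longleftrightarrow>
      (AE t in lebesgue. t \<ge> 0 \<longrightarrow>
        (\<exists>v \<in> ?N (z t). (z has_vector_derivative v) (at t within {0..})))"
    if z: "\<And>s. s \<ge> 0 \<Longrightarrow> z s \<in> X \<times> Y"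
  proof -
    have vel: "v \<in> ?P (z t) \<longleftrightarrow> v \<in> ?N (z t)"
      if "t > 0" "(z has_vector_derivative v) (at t within {0..})" for v t
      by (rule velocity[OF z that])
    have "(t \<ge> 0 \<longrightarrow> (\<exists>v \<in> ?P (z t). (z has_vector_derivative v) (at t within {0..}))) \<longleftrightarrow>
        (t \<ge> 0 \<longrightarrow> (\<exists>v \<in> ?N (z t). (z has_vector_derivative v) (at t within {0..})))"
      if "t \<noteq> 0" for t
      using vel[of t] that by (auto simp: less_le)
    then show ?thesis
      using ae by (intro eventually_subst) (auto elim!: eventually_mono)
  qed
  then show ?thesis
    unfolding viable_caratheodory_solution_def by blast
qed

end
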